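(* Let $m\ge2$ be an integer, let $G=\mathbb{Z}/m\ast\mathbb{Z}/m=\langle a,b\mid a^m=b^m=1\rangle$, and let $\varphi\in\mathrm{Aut}(G)$ be the order-$2$ automorphism interchanging $a$ and $b$. Let $\xi_k$ be the growth function of the corresponding $2$-valued coset group $\mathbb{G}_\varphi(G)$ with respect to the element $g=[a,b]$. If $m\ge3$, then $$\xi_k\sim\frac{r^{k+1}}{mr-2(m-1)}\qquad (k\to\infty),$$ where $r$ is the (unique) positive root of the polynomial $\chi(\lambda)=\lambda^{n}-\lambda^{n-1}-\dots-\lambda-1$ with $n=m-1$. In particular, the growth of $\mathbb{G}_\varphi(G)$ is polynomial if and only if $m=2$.
   Context: Coset group: let $G$ be a group and $\varphi\in\mathrm{Aut}(G)$ an automorphism of finite order $n$. Let $X=G/\langle\varphi\rangle$ be the set of orbits of the cyclic group $\langle\varphi\rangle$ acting on $G$, with quotient map $\pi:G\to X$. The $n$-valued coset group $\mathbb{G}_\varphi(G)$ is the set $X$ with the $n$-valued multiplication $x*y=[\pi(u\,\varphi^i(v)) : 0\le i<n]$ (a multiset of $n$ elements of $X$), where $u\in\pi^{-1}(x)$, $v\in\pi^{-1}(y)$; this is independent of the choice of $u,v$. Its unit is $e=\pi(1)$. Growth function: suppose $\varphi$ cyclically permutes the given generators $f_1,\dots,f_n$ of $G$, and let $g=[f_1,\dots,f_n]\in X$ be their common orbit. Let $g^1$ be the multiset consisting of $g$, and let $g^{k}$ be the multiset union of the multisets $g*x$ for $x$ running over $g^{k-1}$. Then $\xi_k$ ($k\ge0$)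 is the number of distinct elements of $X$ in $\{e\}\cup g\cup g^2\cup\dots\cup g^k$. Polynomial growth means that $\xi_k\le C(k+1)^d$ for all $k\ge 0$, for some constants $C,d>0$. The notation $\sim$ means that the ratio tends to $1$. *)

theory Defs
  imports
    "HOL-Algebra.Group_Action"
    "HOL-Algebra.Multiplicative_Group"
    "HOL-Library.Multiset"
    "HOL-Library.Landau_Symbols"
    "HOL-Computational_Algebra.Polynomial"
begin

section \<open>Groups given by generators and relators\<close>

text \<open>
  A letter \<open>(x, True)\<close> stands for the generator \<open>x\<close> and \<open>(x, False)\<close> for its formal inverse.
\<close>

inductive_set word_eq ::
  "('g \<times> bool) list set \<Rightarrow> (('g \<times> bool) list \<times> ('g \<times> bool) list) set"
  for R :: "('g \<times> bool) list set" where
  cancel: "(u @ [(x, s), (x, \<not> s)] @ v, u @ v) \<in> word_eq R"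
| relator: "r \<in> R \<Longrightarrow> (u @ r @ v, u @ v) \<in> word_eq R"
| refl: "(u, u) \<in> word_eq R"
| sym: "(u, v) \<in> word_eq R \<Longrightarrow> (v, u) \<in> word_eq R"
| trans: "(u, v) \<in> word_eq R \<Longrightarrow> (v, w) \<in> word_eq R \<Longrightarrow> (u, w) \<in> word_eq R"

definition presented_group :: "('g \<times> bool) list set \<Rightarrow> ('g \<times> bool) list set monoid" where
  "presented_group R =
     \<lparr>carrier = UNIV // word_eq R,
      monoid.mult = (\<lambda>A B. \<Union>u\<in>A. \<Union>v\<in>B. word_eq R `` {u @ v}),
      one = word_eq R `` {[]}\<rparr>"

definition presented_gen :: "('g \<times> bool) list set \<Rightarrow> 'g \<Rightarrow> ('g \<times> bool) list set" where
  "presented_gen R x = word_eq R `` {[(x, True)]}"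

lemma equiv_word_eq: "equiv UNIV (word_eq R)"
  by (intro equivI refl_onI symI transI) (auto intro: word_eq.intros)

lemma word_eq_context:
  "(u, v) \<in> word_eq R \<Longrightarrow> (p @ u @ q, p @ v @ q) \<in> word_eq R"
proof (induction rule: word_eq.induct)
  case (cancel u x s v)
  show ?case using word_eq.cancel[of "p @ u" x s "v @ q" R] by simp
next
  case (relator r u v)
  then show ?case using word_eq.relator[of r R "p @ u" "v @ q"] by simp
qed (auto intro: word_eq.intros)

lemma word_eq_append:
  assumes "(u, u') \<in> word_eq R" "(v, v') \<in> word_eq R"
  shows "(u @ v, u' @ v') \<in> word_eq R"
  using word_eq_context[OF assms(1), of "[]" v] word_eq_context[OF assms(2), of u' "[]"]
  by (auto intro: word_eq.trans)

lemma word_class_eq_iff: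
  "word_eq R `` {u} = word_eq R `` {v} \<longleftrightarrow> (u, v) \<in> word_eq R"
  using eq_equiv_class_iff[OF equiv_word_eq] by blast

lemma presented_carrier_iff:
  "A \<in> carrier (presented_group R) \<longleftrightarrow> (\<exists>u. A = word_eq R `` {u})"
  by (auto simp: presented_group_def quotient_def)

lemma presented_one: "\<one>\<^bsub>presented_group R\<^esub> = word_eq R `` {[]}"
  by (simp add: presented_group_def)

lemma presented_mult:
  "word_eq R `` {u} \<otimes>\<^bsub>presented_group R\<^esub> word_eq R `` {v} = word_eq R `` {u @ v}"
proof -
  have "word_eq R `` {p @ q} = word_eq R `` {u @ v}"
    if "p \<in> word_eq R `` {u}" "q \<in> word_eq R `` {v}" for p q
    using that word_eq_append[of u p R v q] by (auto simp: word_class_eq_iff intro: word_eq.sym)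
  then have "(\<Union>p\<in>word_eq R `` {u}. \<Union>q\<in>word_eq R `` {v}. word_eq R `` {p @ q}) =
      (\<Union>p\<in>word_eq R `` {u}. \<Union>q\<in>word_eq R `` {v}. word_eq R `` {u @ v})"
    by (intro SUP_cong HOL.refl)
  moreover have "word_eq R `` {u} \<noteq> {}" "word_eq R `` {v} \<noteq> {}"
    using word_eq.refl[of u R] word_eq.refl[of v R] by fast+
  ultimately show ?thesis
    by (simp add: presented_group_def)
qed

definition inverse_word :: "('g \<times> bool) list \<Rightarrow> ('g \<times> bool) list" where
  "inverse_word w = rev (map (\<lambda>(x, s). (x, \<not> s)) w)"

lemma inverse_word_append: "(inverse_word w @ w, []) \<in> word_eq R"
proof (induction w)
  case Nil
  then show ?case by (auto simp: inverse_word_def intro: word_eq.refl)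
next
  case (Cons l w)
  obtain x s where l: "l = (x, s)" by (cases l)
  have "(inverse_word w @ [(x, \<not> s), (x, \<not> \<not> s)] @ w, inverse_word w @ w) \<in> word_eq R"
    by (rule word_eq.cancel)
  with Cons show ?case by (auto simp: inverse_word_def l intro: word_eq.trans)
qed

lemma group_presented_group: "group (presented_group R)"
proof (rule groupI)
  show one: "\<one>\<^bsub>presented_group R\<^esub> \<in> carrier (presented_group R)"
    by (auto simp: presented_carrier_iff presented_one)
  fix A assume "A \<in> carrier (presented_group R)"
  then obtain u where u: "A = word_eq R `` {u}" by (auto simp: presented_carrier_iff)
  show "\<one>\<^bsub>presented_group R\<^esub> \<otimes>\<^bsub>presented_group R\<^esub> A = A"
    by (simp add: u presented_one presented_mult)
  show "\<exists>B\<in>carrier (presented_group R). B \<otimes>\<^bsub>presented_group R\<^esub> A = \<one>\<^bsub>presented_group R\<^esub>"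
  proof
    show "word_eq R `` {inverse_word u} \<in> carrier (presented_group R)"
      by (auto simp: presented_carrier_iff)
    show "word_eq R `` {inverse_word u} \<otimes>\<^bsub>presented_group R\<^esub> A = \<one>\<^bsub>presented_group R\<^esub>"
      by (simp add: u presented_one presented_mult word_class_eq_iff inverse_word_append)
  qed
  fix B assume "B \<in> carrier (presented_group R)"
  then obtain v where v: "B = word_eq R `` {v}" by (auto simp: presented_carrier_iff)
  show "A \<otimes>\<^bsub>presented_group R\<^esub> B \<in> carrier (presented_group R)"
    by (auto simp: u v presented_mult presented_carrier_iff)
  fix C assume "C \<in> carrier (presented_group R)"
  then obtain w where w: "C = word_eq R `` {w}" by (auto simp: presented_carrier_iff)
  show "A \<otimes>\<^bsub>presented_group R\<^esub> B \<otimes>\<^bsub>presented_group R\<^esub> C =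
        A \<otimes>\<^bsub>presented_group R\<^esub> (B \<otimes>\<^bsub>presented_group R\<^esub> C)"
    by (simp add: u v w presented_mult)
qed

primrec word_eval :: "('a, 'b) monoid_scheme \<Rightarrow> ('g \<Rightarrow> 'a) \<Rightarrow> ('g \<times> bool) list \<Rightarrow> 'a" where
  "word_eval H f [] = \<one>\<^bsub>H\<^esub>"
| "word_eval H f (l # w) =
     (if snd l then f (fst l) else inv\<^bsub>H\<^esub> f (fst l)) \<otimes>\<^bsub>H\<^esub> word_eval H f w"

lemma (in group) word_eval_closed:
  "(\<And>x. f x \<in> carrier G) \<Longrightarrow> word_eval G f w \<in> carrier G"
  by (induction w) auto

lemma (in group) word_eval_append:
  "(\<And>x. f x \<in> carrier G) \<Longrightarrow> word_eval G f (u @ v) = word_eval G f u \<otimes> word_eval G f v"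
  by (induction u) (auto simp: word_eval_closed m_assoc)

lemma (in group) word_eval_cong:
  assumes f: "\<And>x. f x \<in> carrier G" and R: "\<And>r. r \<in> R \<Longrightarrow> word_eval G f r = \<one>"
  shows "(u, v) \<in> word_eq R \<Longrightarrow> word_eval G f u = word_eval G f v"
proof (induction rule: word_eq.induct)
  case (cancel u x s v)
  have "f x \<otimes> (inv f x \<otimes> word_eval G f v) = word_eval G f v"
    "inv f x \<otimes> (f x \<otimes> word_eval G f v) = word_eval G f v"
    by (simp_all add: f word_eval_closed flip: m_assoc)
  then show ?case by (simp add: f word_eval_append)
qed (auto simp: f R word_eval_append word_eval_closed)

lemma (in group) presented_group_lift:
  assumes f: "\<And>x. f x \<in> carrier G" and R: "\<And>r. r \<in> R \<Longrightarrow> word_eval G f r = \<one>"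
  shows "\<exists>h \<in> hom (presented_group R) G. \<forall>x. h (presented_gen R x) = f x"
proof
  define h where "h A = word_eval G f (SOME w. w \<in> A)" for A
  have h: "h (word_eq R `` {w}) = word_eval G f w" for w
  proof -
    have "w \<in> word_eq R `` {w}" by (auto intro: word_eq.refl)
    then have "(SOME u. u \<in> word_eq R `` {w}) \<in> word_eq R `` {w}" by (rule someI)
    then show ?thesis
      unfolding h_def using word_eval_cong[OF f R] by (metis Image_singleton_iff)
  qed
  show "h \<in> hom (presented_group R) G"
    by (auto simp: hom_def presented_carrier_iff h presented_mult word_eval_closed f word_eval_append)
  show "\<forall>x. h (presented_gen R x) = f x"
    by (simp add: presented_gen_def h f)
qed


section \<open>Coset groups and their growth\<close>

text \<open>
  \<open>coset_proj G \<phi>\<close> is the quotient map \<open>\<pi>\<close> onto the set \<open>coset_carrier G \<phi>\<close> of orbits of \<open>\<langle>\<phi>\<rangle>\<close>,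
  with \<open>\<langle>\<phi>\<rangle>\<close> taken inside the library's group of (extensional) automorphisms. In \<open>coset_mult\<close> the
  number \<open>n\<close> of values is the order of \<open>\<phi>\<close>, and the choice of representatives is immaterial by
  \<open>coset_mult_proj\<close> below.
\<close>

definition coset_proj :: "('a, 'b) monoid_scheme \<Rightarrow> ('a \<Rightarrow> 'a) \<Rightarrow> 'a \<Rightarrow> 'a set" where
  "coset_proj G \<phi> =
     orbit (AutoGroup G\<lparr>carrier := generate (AutoGroup G) {\<phi>}\<rparr>) (\<lambda>\<psi>. \<psi>)"

definition coset_carrier :: "('a, 'b) monoid_scheme \<Rightarrow> ('a \<Rightarrow> 'a) \<Rightarrow> 'a set set" where
  "coset_carrier G \<phi> =
     orbits (AutoGroup G\<lparr>carrier := generate (AutoGroup G) {\<phi>}\<rparr>) (carrier G) (\<lambda>\<psi>. \<psi>)"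

lemma coset_carrier_eq: "coset_carrier G \<phi> = coset_proj G \<phi> ` carrier G"
  by (auto simp: coset_carrier_def coset_proj_def orbits_def)

definition coset_one :: "('a, 'b) monoid_scheme \<Rightarrow> ('a \<Rightarrow> 'a) \<Rightarrow> 'a set" where
  "coset_one G \<phi> = coset_proj G \<phi> \<one>\<^bsub>G\<^esub>"

definition coset_mult ::
  "('a, 'b) monoid_scheme \<Rightarrow> ('a \<Rightarrow> 'a) \<Rightarrow> 'a set \<Rightarrow> 'a set \<Rightarrow> 'a set multiset" where
  "coset_mult G \<phi> x y =
     (let u = (SOME u. u \<in> carrier G \<and> coset_proj G \<phi> u = x);
          v = (SOME v. v \<in> carrier G \<and> coset_proj G \<phi> v = y)
      in image_mset (\<lambda>i. coset_proj G \<phi> (u \<otimes>\<^bsub>G\<^esub> (\<phi> ^^ i) v))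
           (mset_set {..<group.ord (AutoGroup G) \<phi>}))"

text \<open>Powers start at \<open>g\<^sup>1 = [g]\<close>; the value at \<open>0\<close> is a convention that \<open>coset_growth\<close> does not use.\<close>

fun coset_pow ::
  "('a, 'b) monoid_scheme \<Rightarrow> ('a \<Rightarrow> 'a) \<Rightarrow> 'a set \<Rightarrow> nat \<Rightarrow> 'a set multiset" where
  "coset_pow G \<phi> g 0 = {#coset_one G \<phi>#}"
| "coset_pow G \<phi> g (Suc 0) = {#g#}"
| "coset_pow G \<phi> g (Suc (Suc k)) =
     \<Sum>\<^sub># (image_mset (coset_mult G \<phi> g) (coset_pow G \<phi> g (Suc k)))"

definition coset_growth :: "('a, 'b) monoid_scheme \<Rightarrow> ('a \<Rightarrow> 'a) \<Rightarrow> 'a set \<Rightarrow> nat \<Rightarrow> nat" where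
  "coset_growth G \<phi> g k =
     card ({coset_one G \<phi>} \<union> (\<Union>j\<in>{1..k}. set_mset (coset_pow G \<phi> g j)))"

definition polynomial_growth :: "(nat \<Rightarrow> nat) \<Rightarrow> bool" where
  "polynomial_growth \<xi> \<longleftrightarrow>
     (\<exists>C d :: real. C > 0 \<and> d > 0 \<and> (\<forall>k. real (\<xi> k) \<le> C * (real k + 1) powr d))"

context group
begin

lemma AutoGroup_pow_apply:
  fixes i :: nat
  assumes "\<phi> \<in> auto G" "x \<in> carrier G"
  shows "(\<phi> [^]\<^bsub>AutoGroup G\<^esub> i) x = (\<phi> ^^ i) x"
proof -
  have mem: "\<phi> [^]\<^bsub>AutoGroup G\<^esub> i \<in> auto G" for i :: nat
    using monoid.nat_pow_closed[OF group.is_monoid[OF AutoGroup], of \<phi> i] assms(1)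
    by (simp add: AutoGroup_def)
  have bij: "\<psi> \<in> Bij (carrier G)" if "\<psi> \<in> auto G" for \<psi>
    using that by (simp add: auto_def)
  show ?thesis
    using assms(2)
  proof (induction i arbitrary: x)
    case 0
    then show ?case by (simp add: AutoGroup_def BijGroup_def)
  next
    case (Suc i)
    have "\<phi> x \<in> carrier G"
      using assms(1) Suc.prems by (auto simp: auto_def hom_def)
    then have IH: "(\<phi> [^]\<^bsub>AutoGroup G\<^esub> i) (\<phi> x) = (\<phi> ^^ i) (\<phi> x)"
      by (rule Suc.IH)
    have mult: "(\<psi> \<otimes>\<^bsub>AutoGroup G\<^esub> \<phi>) x = \<psi> (\<phi> x)" if "\<psi> \<in> Bij (carrier G)" for \<psi>
      using that Suc.prems bij[OF assms(1)]
      by (simp add: AutoGroup_def BijGroup_def compose_def)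
    have "(\<phi> [^]\<^bsub>AutoGroup G\<^esub> Suc i) x = (\<phi> [^]\<^bsub>AutoGroup G\<^esub> i) (\<phi> x)"
      unfolding monoid.nat_pow_Suc[OF group.is_monoid[OF AutoGroup]] by (rule mult[OF bij[OF mem]])
    also have "\<dots> = (\<phi> ^^ Suc i) x"
      unfolding IH funpow_Suc_right by simp
    finally show ?case .
  qed
qed

lemma auto_funpow_hom:
  assumes "\<phi> \<in> auto G"
  shows "\<phi> ^^ i \<in> hom G G"
  using assms by (induction i) (auto simp: auto_def hom_def Pi_iff)

lemma auto_funpow_ord:
  assumes "\<phi> \<in> auto G" "x \<in> carrier G"
  shows "(\<phi> ^^ (group.ord (AutoGroup G) \<phi> * q)) x = x"
proof -
  have "\<phi> \<in> carrier (AutoGroup G)" using assms(1) by (simp add: AutoGroup_def)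
  then have "\<phi> [^]\<^bsub>AutoGroup G\<^esub> (group.ord (AutoGroup G) \<phi> * q) = \<one>\<^bsub>AutoGroup G\<^esub>"
    using group.pow_eq_id[OF AutoGroup] by simp
  then show ?thesis
    using AutoGroup_pow_apply[OF assms, symmetric] assms(2)
    by (simp add: AutoGroup_def BijGroup_def)
qed

lemma coset_proj_eq:
  assumes "\<phi> \<in> auto G" "group.ord (AutoGroup G) \<phi> > 0" "x \<in> carrier G"
  shows "coset_proj G \<phi> x = range (\<lambda>i. (\<phi> ^^ i) x)"
proof -
  let ?A = "AutoGroup G"
  have A: "group ?A" by (rule AutoGroup)
  have \<phi>: "\<phi> \<in> carrier ?A" using assms(1) by (simp add: AutoGroup_def)
  have "\<phi> [^]\<^bsub>?A\<^esub> k \<in> range (\<lambda>i :: nat. \<phi> [^]\<^bsub>?A\<^esub> i)" for k :: int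
  proof -
    define l where "l = k mod int (group.ord ?A \<phi>)"
    have "int (group.ord ?A \<phi>) dvd l - k"
      unfolding mod_eq_dvd_iff[symmetric] l_def by (rule mod_mod_trivial)
    then have "\<phi> [^]\<^bsub>?A\<^esub> k = \<phi> [^]\<^bsub>?A\<^esub> l"
      using group.int_pow_eq[OF A \<phi>] by blast
    moreover have "l = int (nat l)" using assms(2) by (simp add: l_def)
    ultimately have "\<phi> [^]\<^bsub>?A\<^esub> k = \<phi> [^]\<^bsub>?A\<^esub> nat l" by (metis int_pow_int)
    then show ?thesis by blast
  qed
  moreover have "\<phi> [^]\<^bsub>?A\<^esub> i \<in> range (\<lambda>k :: int. \<phi> [^]\<^bsub>?A\<^esub> k)" for i :: nat
    using int_pow_int[of ?A \<phi> i] by (metis rangeI)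
  ultimately have "generate ?A {\<phi>} = range (\<lambda>i :: nat. \<phi> [^]\<^bsub>?A\<^esub> i)"
    unfolding group.generate_pow[OF A \<phi>] by auto
  then have "coset_proj G \<phi> x = range (\<lambda>i :: nat. (\<phi> [^]\<^bsub>AutoGroup G\<^esub> i) x)"
    unfolding coset_proj_def orbit_def by auto
  then show ?thesis
    using AutoGroup_pow_apply[OF assms(1,3)] by simp
qed

lemma coset_proj_funpow:
  assumes \<phi>: "\<phi> \<in> auto G" "group.ord (AutoGroup G) \<phi> > 0" and x: "x \<in> carrier G"
  shows "coset_proj G \<phi> ((\<phi> ^^ i) x) = coset_proj G \<phi> x"
proof -
  define n where "n = group.ord (AutoGroup G) \<phi>"
  have ix: "(\<phi> ^^ i) x \<in> carrier G"
    using auto_funpow_hom[OF \<phi>(1)] x by (auto simp: hom_def)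
  have "(\<phi> ^^ j) x = (\<phi> ^^ (j + (n - 1) * i)) ((\<phi> ^^ i) x)" for j
  proof -
    have "j + (n - 1) * i + i = j + n * i"
      using \<phi>(2) by (cases n) (auto simp: n_def)
    then have "(\<phi> ^^ (j + (n - 1) * i)) ((\<phi> ^^ i) x) = (\<phi> ^^ (j + n * i)) x"
      by (metis comp_apply funpow_add)
    also have "\<dots> = (\<phi> ^^ j) x"
      using auto_funpow_ord[OF \<phi>(1) x] by (simp add: funpow_add n_def)
    finally show ?thesis by simp
  qed
  moreover have "(\<phi> ^^ j) ((\<phi> ^^ i) x) = (\<phi> ^^ (j + i)) x" for j
    by (simp add: funpow_add)
  ultimately show ?thesis
    unfolding coset_proj_eq[OF \<phi> ix] coset_proj_eq[OF \<phi> x] by blast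
qed

lemma coset_mult_proj:
  assumes \<phi>: "\<phi> \<in> auto G" "group.ord (AutoGroup G) \<phi> > 0"
    and u: "u \<in> carrier G" and v: "v \<in> carrier G"
  shows "coset_mult G \<phi> (coset_proj G \<phi> u) (coset_proj G \<phi> v) =
    image_mset (\<lambda>i. coset_proj G \<phi> (u \<otimes> (\<phi> ^^ i) v))
      (mset_set {..<group.ord (AutoGroup G) \<phi>})"
proof -
  define n where "n = group.ord (AutoGroup G) \<phi>"
  define F where "F i = coset_proj G \<phi> (u \<otimes> (\<phi> ^^ i) v)" for i
  have ex: "\<exists>i. y = (\<phi> ^^ i) x"
    if "x \<in> carrier G" "y \<in> carrier G" "coset_proj G \<phi> y = coset_proj G \<phi> x" for x y
  proof -
    have "(\<phi> ^^ 0) y \<in> coset_proj G \<phi> y"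
      unfolding coset_proj_eq[OF \<phi> that(2)] by (rule rangeI)
    then show ?thesis using that coset_proj_eq[OF \<phi> that(1)] by auto
  qed
  define u' where "u' = (SOME w. w \<in> carrier G \<and> coset_proj G \<phi> w = coset_proj G \<phi> u)"
  define v' where "v' = (SOME w. w \<in> carrier G \<and> coset_proj G \<phi> w = coset_proj G \<phi> v)"
  have "u' \<in> carrier G \<and> coset_proj G \<phi> u' = coset_proj G \<phi> u"
    unfolding u'_def by (rule someI) (use u in auto)
  then obtain a where a: "u' = (\<phi> ^^ a) u" using ex u by blast
  have "v' \<in> carrier G \<and> coset_proj G \<phi> v' = coset_proj G \<phi> v"
    unfolding v'_def by (rule someI) (use v in auto)
  then obtain b where b: "v' = (\<phi> ^^ b) v" using ex v by blast
  define c where "c = b + (n - 1) * a"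
  have pow_mod: "(\<phi> ^^ i) v = (\<phi> ^^ (i mod n)) v" for i
  proof -
    have "(\<phi> ^^ i) v = (\<phi> ^^ (i mod n)) ((\<phi> ^^ (n * (i div n))) v)"
      by (metis comp_apply funpow_add mod_mult_div_eq)
    then show ?thesis using auto_funpow_ord[OF \<phi>(1) v] by (simp add: n_def)
  qed
  have F: "coset_proj G \<phi> (u' \<otimes> (\<phi> ^^ i) v') = F ((i + c) mod n)" for i
  proof -
    have "a + (i + c) = i + b + n * a"
      using \<phi>(2) by (cases n) (auto simp: n_def c_def)
    then have "(\<phi> ^^ a) ((\<phi> ^^ (i + c)) v) = (\<phi> ^^ (i + b + n * a)) v"
      by (metis comp_apply funpow_add)
    also have "\<dots> = (\<phi> ^^ i) v'"
      using auto_funpow_ord[OF \<phi>(1) v] by (simp add: funpow_add n_def b)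
    finally have "u' \<otimes> (\<phi> ^^ i) v' = (\<phi> ^^ a) u \<otimes> (\<phi> ^^ a) ((\<phi> ^^ (i + c)) v)"
      by (simp add: a)
    also have "\<dots> = (\<phi> ^^ a) (u \<otimes> (\<phi> ^^ (i + c)) v)"
      using auto_funpow_hom[OF \<phi>(1), of a] auto_funpow_hom[OF \<phi>(1), of "i + c"] u v
      by (auto simp: hom_def Pi_iff)
    finally have "coset_proj G \<phi> (u' \<otimes> (\<phi> ^^ i) v') = F (i + c)"
      using auto_funpow_hom[OF \<phi>(1), of "i + c"] u v
      by (auto simp: F_def hom_def Pi_iff intro!: coset_proj_funpow[OF \<phi>])
    then show ?thesis using pow_mod[of "i + c"] by (simp add: F_def)
  qed
  have n: "n > 0" using \<phi>(2) by (simp add: n_def)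
  have inj: "inj_on (\<lambda>i. (i + c) mod n) {..<n}"
  proof (rule inj_onI)
    fix i j assume ij: "i \<in> {..<n}" "j \<in> {..<n}" and "(i + c) mod n = (j + c) mod n"
    then have "int n dvd (int i + int c) - (int j + int c)"
      by (metis mod_eq_dvd_iff of_nat_add zmod_int)
    then have "int i mod int n = int j mod int n"
      by (simp add: mod_eq_dvd_iff)
    then show "i = j" using ij by simp
  qed
  have "(\<lambda>i. (i + c) mod n) ` {..<n} = {..<n}"
    by (rule card_subset_eq) (use n in \<open>auto simp: card_image[OF inj]\<close>)
  then have "image_mset (\<lambda>i. (i + c) mod n) (mset_set {..<n}) = mset_set {..<n}"
    using image_mset_mset_set[OF inj] by simp
  then have "image_mset F (mset_set {..<n}) =
      image_mset F (image_mset (\<lambda>i. (i + c) mod n) (mset_set {..<n}))"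
    by simp
  also have "\<dots> = image_mset (\<lambda>i. coset_proj G \<phi> (u' \<otimes> (\<phi> ^^ i) v')) (mset_set {..<n})"
    by (simp add: F multiset.map_comp comp_def)
  finally show ?thesis
    unfolding coset_mult_def u'_def[symmetric] v'_def[symmetric] n_def[symmetric] F_def Let_def
    by simp
qed

end


section \<open>The free product of two copies of a finite cyclic group\<close>

text \<open>
  The free product of two groups is presented by the disjoint union of their generators and relators.
\<close>

datatype gen = Gen_a | Gen_b

definition cyclic_relators :: "nat \<Rightarrow> (gen \<times> bool) list set" where
  "cyclic_relators m = {replicate m (Gen_a, True), replicate m (Gen_b, True)}"

abbreviation cyclic_free_product :: "nat \<Rightarrow> (gen \<times> bool) list set monoid" where
  "cyclic_free_product m \<equiv> presented_group (cyclic_relators m)"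

abbreviation elem_a :: "nat \<Rightarrow> (gen \<times> bool) list set" where
  "elem_a m \<equiv> presented_gen (cyclic_relators m) Gen_a"

abbreviation elem_b :: "nat \<Rightarrow> (gen \<times> bool) list set" where
  "elem_b m \<equiv> presented_gen (cyclic_relators m) Gen_b"

lemma presented_gen_closed: "presented_gen R x \<in> carrier (presented_group R)"
  by (auto simp: presented_gen_def presented_carrier_iff)

lemma inv_presented_gen:
  "inv\<^bsub>presented_group R\<^esub> presented_gen R x = word_eq R `` {[(x, False)]}"
proof (rule group.inv_equality[OF group_presented_group])
  show "word_eq R `` {[(x, False)]} \<otimes>\<^bsub>presented_group R\<^esub> presented_gen R x =
      \<one>\<^bsub>presented_group R\<^esub>"
    using word_eq.cancel[of "[]" x False "[]" R]
    by (simp add: presented_gen_def presented_mult presented_one word_class_eq_iff)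
qed (auto simp: presented_gen_def presented_carrier_iff)

lemma word_eval_presented_gen:
  "word_eval (presented_group R) (\<lambda>x. presented_gen R (f x)) w =
     word_eq R `` {map (\<lambda>(x, s). (f x, s)) w}"
proof (induction w)
  case Nil
  then show ?case by (simp add: presented_one)
next
  case (Cons l w)
  obtain x s where l: "l = (x, s)" by (cases l)
  have "(if s then presented_gen R (f x) else inv\<^bsub>presented_group R\<^esub> presented_gen R (f x)) =
      word_eq R `` {[(f x, s)]}"
    unfolding inv_presented_gen by (simp add: presented_gen_def)
  then show ?case
    using Cons.IH presented_mult[of R "[(f x, s)]"] by (cases s) (simp_all add: l)
qed

lemma (in group) presented_hom_eval:
  assumes "h \<in> hom (presented_group R) G"
  shows "h (word_eq R `` {w}) = word_eval G (\<lambda>x. h (presented_gen R x)) w"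
proof -
  have hom: "group_hom (presented_group R) G h"
    by (intro group_hom.intro group_hom_axioms.intro group_presented_group group_axioms assms)
  show ?thesis
  proof (induction w)
    case Nil
    show ?case
      using group_hom.hom_one[OF hom] unfolding presented_one word_eval.simps .
  next
    case (Cons l w)
    obtain x s where l: "l = (x, s)" by (cases l)
    define A where "A = word_eq R `` {[(x, s)]}"
    define B where "B = word_eq R `` {w}"
    have A: "A \<in> carrier (presented_group R)" and B: "B \<in> carrier (presented_group R)"
      unfolding A_def B_def presented_carrier_iff by blast+
    have "h A = (if s then h (presented_gen R x) else inv h (presented_gen R x))"
      using group_hom.hom_inv[OF hom presented_gen_closed[of R x]]
      unfolding A_def inv_presented_gen by (cases s) (simp_all add: presented_gen_def)
    moreover have "h (word_eq R `` {l # w}) = h A \<otimes> h B"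
      using presented_mult[of R "[(x, s)]" w] hom_mult[OF assms A B]
      by (simp add: A_def B_def l)
    ultimately show ?case
      using Cons.IH by (simp add: l B_def)
  qed
qed

lemma (in group) word_eval_replicate:
  "f x \<in> carrier G \<Longrightarrow> word_eval G f (replicate m (x, True)) = f x [^] m"
  by (induction m) (simp_all only: replicate.simps word_eval.simps nat_pow_Suc2 nat_pow_0 fst_conv snd_conv if_True)

lemma elem_a_neq_elem_b:
  assumes "m \<ge> 2"
  shows "elem_a m \<noteq> elem_b m"
proof -
  interpret Z: group "integer_mod_group m" by (rule group_integer_mod_group)
  define f where "f x = (if x = Gen_a then 1 else 0 :: int)" for x
  have f: "f x \<in> carrier (integer_mod_group m)" for x
    using assms by (auto simp: f_def)
  have "word_eval (integer_mod_group m) f r = \<one>\<^bsub>integer_mod_group m\<^esub>"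
    if "r \<in> cyclic_relators m" for r
    using that by (auto simp: cyclic_relators_def Z.word_eval_replicate f)
  from Z.presented_group_lift[OF f this] obtain h where "\<forall>x. h (presented_gen (cyclic_relators m) x) = f x"
    by blast
  then have "h (elem_a m) \<noteq> h (elem_b m)" by (simp add: f_def)
  then show ?thesis by auto
qed

primrec swap_gen :: "gen \<Rightarrow> gen" where
  "swap_gen Gen_a = Gen_b"
| "swap_gen Gen_b = Gen_a"

lemma swap_hom_apply:
  assumes "\<phi> \<in> hom (cyclic_free_product m) (cyclic_free_product m)"
    and "\<phi> (elem_a m) = elem_b m" "\<phi> (elem_b m) = elem_a m"
  shows "\<phi> (word_eq (cyclic_relators m) `` {w}) =
    word_eq (cyclic_relators m) `` {map (\<lambda>(x, s). (swap_gen x, s)) w}"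
proof -
  have "\<phi> (presented_gen (cyclic_relators m) x) =
      presented_gen (cyclic_relators m) (swap_gen x)" for x
    using assms(2,3) by (cases x) auto
  then show ?thesis
    using group.presented_hom_eval[OF group_presented_group assms(1)]
    by (simp add: word_eval_presented_gen)
qed

lemma swap_hom_involution:
  assumes "\<phi> \<in> hom (cyclic_free_product m) (cyclic_free_product m)"
    and "\<phi> (elem_a m) = elem_b m" "\<phi> (elem_b m) = elem_a m"
    and "x \<in> carrier (cyclic_free_product m)"
  shows "\<phi> (\<phi> x) = x"
proof -
  have "swap_gen (swap_gen g) = g" for g by (cases g) auto
  then have "(\<lambda>(x, s :: bool). (swap_gen x, s)) \<circ> (\<lambda>(x, s). (swap_gen x, s)) = id"
    by auto
  with assms(4) show ?thesis
    by (auto simp: presented_carrier_iff swap_hom_apply[OF assms(1-3)])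
qed

lemma swap_automorphism_order:
  assumes "m \<ge> 2" and \<phi>: "\<phi> \<in> auto (cyclic_free_product m)"
    and ab: "\<phi> (elem_a m) = elem_b m" "\<phi> (elem_b m) = elem_a m"
  shows "group.ord (AutoGroup (cyclic_free_product m)) \<phi> = 2"
proof -
  interpret G: group "cyclic_free_product m" by (rule group_presented_group)
  have A: "group (AutoGroup (cyclic_free_product m))" by (rule G.AutoGroup)
  have mem: "\<phi> \<in> carrier (AutoGroup (cyclic_free_product m))"
    using \<phi> by (simp add: AutoGroup_def)
  have hom: "\<phi> \<in> hom (cyclic_free_product m) (cyclic_free_product m)"
    and Bij: "\<phi> \<in> Bij (carrier (cyclic_free_product m))"
    using \<phi> by (auto simp: auto_def)
  have "\<phi> \<otimes>\<^bsub>AutoGroup (cyclic_free_product m)\<^esub> \<phi> = \<one>\<^bsub>AutoGroup (cyclic_free_product m)\<^esub>"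
    using Bij swap_hom_involution[OF hom ab]
    by (auto simp: AutoGroup_def BijGroup_def compose_def fun_eq_iff restrict_def)
  then have "\<phi> [^]\<^bsub>AutoGroup (cyclic_free_product m)\<^esub> (2 :: nat) =
      \<one>\<^bsub>AutoGroup (cyclic_free_product m)\<^esub>"
    using mem monoid.l_one[OF group.is_monoid[OF A]] by (simp add: numeral_2_eq_2)
  then have "group.ord (AutoGroup (cyclic_free_product m)) \<phi> dvd 2" using group.pow_eq_id[OF A mem] by simp
  moreover have "group.ord (AutoGroup (cyclic_free_product m)) \<phi> \<noteq> 1"
  proof
    assume "group.ord (AutoGroup (cyclic_free_product m)) \<phi> = 1"
    then have "\<phi> = (\<lambda>x\<in>carrier (cyclic_free_product m). x)"
      using group.ord_eq_1[OF A mem] by (simp add: AutoGroup_def BijGroup_def)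
    then have "\<phi> (elem_a m) = elem_a m" by (simp add: presented_gen_closed)
    with ab(1) elem_a_neq_elem_b[OF assms(1)] show False by simp
  qed
  ultimately show ?thesis
    using dvd_imp_le[of "group.ord (AutoGroup (cyclic_free_product m)) \<phi>" 2] by (cases "group.ord (AutoGroup (cyclic_free_product m)) \<phi> = 0") auto
qed

lemma ex1_swap_automorphism:
  assumes "m \<ge> 2"
  shows "\<exists>!\<phi>. \<phi> \<in> auto (cyclic_free_product m) \<and>
    group.ord (AutoGroup (cyclic_free_product m)) \<phi> = 2 \<and>
    \<phi> (elem_a m) = elem_b m \<and> \<phi> (elem_b m) = elem_a m"
proof -
  let ?G = "cyclic_free_product m"
  interpret G: group ?G by (rule group_presented_group)
  have gen_pow: "presented_gen (cyclic_relators m) x [^]\<^bsub>?G\<^esub> m = \<one>\<^bsub>?G\<^esub>" for x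
  proof -
    have "replicate m (x, True) \<in> cyclic_relators m"
      by (cases x) (auto simp: cyclic_relators_def)
    from word_eq.relator[OF this, of "[]" "[]"]
    have "word_eq (cyclic_relators m) `` {replicate m (x, True)} = \<one>\<^bsub>?G\<^esub>"
      by (simp add: presented_one word_class_eq_iff)
    then show ?thesis
      using G.word_eval_replicate[of "presented_gen (cyclic_relators m)" x m]
        word_eval_presented_gen[of "cyclic_relators m" "\<lambda>x. x" "replicate m (x, True)"]
      by (simp add: presented_gen_closed)
  qed
  have "word_eval ?G (\<lambda>x. presented_gen (cyclic_relators m) (swap_gen x)) r = \<one>\<^bsub>?G\<^esub>"
    if "r \<in> cyclic_relators m" for r
  proof -
    from that obtain x where "r = replicate m (x, True)" by (auto simp: cyclic_relators_def)
    then show ?thesis by (simp add: G.word_eval_replicate presented_gen_closed gen_pow)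
  qed
  from G.presented_group_lift[OF presented_gen_closed this] obtain h where h: "h \<in> hom ?G ?G"
    and h_gen: "\<And>x. h (presented_gen (cyclic_relators m) x) =
      presented_gen (cyclic_relators m) (swap_gen x)"
    by blast
  have ab: "h (elem_a m) = elem_b m" "h (elem_b m) = elem_a m"
    by (simp_all add: h_gen)
  have closed: "h x \<in> carrier ?G" if "x \<in> carrier ?G" for x
    using h that by (auto simp: hom_def)
  define \<phi> where "\<phi> = restrict h (carrier ?G)"
  have "bij_betw h (carrier ?G) (carrier ?G)"
    by (rule bij_betw_byWitness[where f' = h]) (auto simp: swap_hom_involution[OF h ab] closed)
  then have "\<phi> \<in> auto ?G"
    using h by (auto simp: auto_def Bij_def \<phi>_def hom_def Pi_iff cong: bij_betw_cong)
  moreover have "\<phi> (elem_a m) = elem_b m" "\<phi> (elem_b m) = elem_a m"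
    by (simp_all add: \<phi>_def presented_gen_closed ab)
  ultimately show ?thesis
  proof (intro ex1I[of _ \<phi>] conjI swap_automorphism_order[OF assms])
    fix \<psi>
    assume \<psi>: "\<psi> \<in> auto ?G \<and> group.ord (AutoGroup ?G) \<psi> = 2 \<and>
      \<psi> (elem_a m) = elem_b m \<and> \<psi> (elem_b m) = elem_a m"
    show "\<psi> = \<phi>"
    proof (rule extensionalityI[of _ "carrier ?G"])
      show "\<psi> \<in> extensional (carrier ?G)" using \<psi> by (simp add: auto_def Bij_def)
      show "\<phi> \<in> extensional (carrier ?G)" by (simp add: \<phi>_def)
      fix x assume "x \<in> carrier ?G"
      moreover from this obtain w where "x = word_eq (cyclic_relators m) `` {w}"
        by (auto simp: presented_carrier_iff)
      moreover have "\<psi> \<in> hom ?G ?G" using \<psi> by (simp add: auto_def)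
      ultimately show "\<psi> x = \<phi> x"
        using \<psi> by (simp add: \<phi>_def swap_hom_apply[OF h ab] swap_hom_apply[of \<psi> m])
    qed
  qed auto
qed

text \<open>The common orbit of the two generators, usable as the element \<open>g = [a, b]\<close>.\<close>

lemma coset_proj_elem_a:
  assumes "m \<ge> 2" "\<phi> \<in> auto (cyclic_free_product m)"
    and "\<phi> (elem_a m) = elem_b m" "\<phi> (elem_b m) = elem_a m"
  shows "coset_proj (cyclic_free_product m) \<phi> (elem_a m) = {elem_a m, elem_b m}"
proof -
  interpret G: group "cyclic_free_product m" by (rule group_presented_group)
  have pow: "(\<phi> ^^ i) (elem_a m) = (if even i then elem_a m else elem_b m)" for i
    by (induction i) (auto simp: assms)
  have "range (\<lambda>i. (\<phi> ^^ i) (elem_a m)) = {elem_a m, elem_b m}"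
  proof
    show "range (\<lambda>i. (\<phi> ^^ i) (elem_a m)) \<subseteq> {elem_a m, elem_b m}"
      unfolding pow by auto
    show "{elem_a m, elem_b m} \<subseteq> range (\<lambda>i. (\<phi> ^^ i) (elem_a m))"
      using rangeI[of "\<lambda>i. (\<phi> ^^ i) (elem_a m)" 0] rangeI[of "\<lambda>i. (\<phi> ^^ i) (elem_a m)" 1]
      by (simp add: assms)
  qed
  then show ?thesis
    using G.coset_proj_eq[OF assms(2) _ presented_gen_closed] swap_automorphism_order[OF assms]
    by simp
qed


definition chi_poly :: "nat \<Rightarrow> real poly" where
  "chi_poly n = [:0, 1:] ^ n - (\<Sum>i<n. [:0, 1:] ^ i)"

end

theory Submission
  imports Defs "HOL-Real_Asymp.Real_Asymp"
begin

text \<open>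
  The support of \<open>g\<^sup>k\<close> is the image under \<open>\<pi>\<close> of the positive words of length \<open>k\<close> in \<open>a\<close>, \<open>b\<close>. By the
  normal form theorem for the free product, and as \<open>\<phi>\<close> interchanges the normal forms starting with
  \<open>a\<close> and those starting with \<open>b\<close>, \<open>\<xi>\<^sub>k\<close> is the number of lists over \<open>{1..n}\<close>, \<open>n = m - 1\<close>, with sum at
  most \<open>k\<close>. Up to an affine change these numbers satisfy the recurrence with characteristic
  polynomial \<open>\<chi>\<close>, so that \<open>\<xi>\<^sub>k\<close> differs from \<open>r\<^bsup>k+1\<^esup> / (m r - 2 (m - 1))\<close> by a bounded amount.
\<close>

section \<open>Linear recurrences of multibonacci type\<close>

text \<open>From index \<open>n\<close> on, the absolute value of each term is at most a subconvex
  combination of those of its predecessors, so any bound on the first \<open>n\<close> terms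
  persists. The sum of their absolute values is such a bound.\<close>

lemma bounded_of_subconvex_recurrence:
  fixes Z :: "nat \<Rightarrow> real"
  assumes rec: "\<And>j. Z (j + n) = (\<Sum>l<n. w l * Z (j + l))"
    and w: "\<And>l. 0 \<le> w l" "(\<Sum>l<n. w l) \<le> 1"
  shows "\<bar>Z j\<bar> \<le> (\<Sum>i<n. \<bar>Z i\<bar>)" (is "_ \<le> ?M")
proof (induction j rule: less_induct)
  case (less j)
  show ?case
  proof (cases "j < n")
    case True
    then show ?thesis by (intro member_le_sum) auto
  next
    case False
    define i where "i = j - n"
    have j: "j = i + n" using False by (simp add: i_def)
    have "\<bar>Z j\<bar> \<le> (\<Sum>l<n. \<bar>w l * Z (i + l)\<bar>)"
      unfolding j rec by (rule sum_abs)
    also have "\<dots> \<le> (\<Sum>l<n. w l * ?M)"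
      using less.IH by (intro sum_mono) (auto simp: abs_mult j w intro!: mult_left_mono)
    also have "\<dots> = (\<Sum>l<n. w l) * ?M" by (simp add: sum_distrib_right)
    also have "\<dots> \<le> 1 * ?M" by (intro mult_right_mono w sum_nonneg) auto
    finally show ?thesis by simp
  qed
qed

section \<open>The positive root of \<open>chi_poly n\<close>\<close>

lemma poly_chi_poly: "poly (chi_poly n) x = x ^ n - (\<Sum>i<n. x ^ i)"
  by (simp add: chi_poly_def poly_sum)

text \<open>Division by \<open>x ^ n\<close>. In this form the sum visibly decreases in
  \<open>x\<close>, which gives uniqueness, and at the root the powers of \<open>1 / x\<close>
  become weights of total 1.\<close>

lemma chi_poly_root_iff:
  assumes "x > 0"
  shows "poly (chi_poly n) x = 0 \<longleftrightarrow> (\<Sum>i<n. (1 / x) ^ Suc i) = 1"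
proof -
  have "x ^ n * (\<Sum>i<n. (1 / x) ^ Suc i) = (\<Sum>i<n. x ^ (n - Suc i))"
    unfolding sum_distrib_left
  proof (intro sum.cong HOL.refl)
    fix i assume "i \<in> {..<n}"
    then have "x ^ n = x ^ (n - Suc i) * x ^ Suc i" by (simp flip: power_add del: power_Suc)
    then show "x ^ n * (1 / x) ^ Suc i = x ^ (n - Suc i)"
      using assms by (simp add: power_one_over)
  qed
  also have "\<dots> = (\<Sum>i<n. x ^ i)" by (rule sum.nat_diff_reindex)
  finally have "poly (chi_poly n) x = x ^ n * (1 - (\<Sum>i<n. (1 / x) ^ Suc i))"
    by (simp add: poly_chi_poly right_diff_distrib)
  with assms show ?thesis by simp
qed

lemma chi_poly_root_unique:
  assumes "n \<ge> 1" "x > 0" "y > 0" "poly (chi_poly n) x = 0" "poly (chi_poly n) y = 0"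
  shows "x = y"
proof -
  have False if "x < y" "x > 0" "poly (chi_poly n) x = 0" "poly (chi_poly n) y = 0" for x y
  proof -
    have "(\<Sum>i<n. (1 / y) ^ Suc i) < (\<Sum>i<n. (1 / x) ^ Suc i)"
      using that assms(1)
      by (intro sum_strict_mono power_strict_mono) (auto simp: divide_strict_left_mono lessThan_empty_iff)
    with that show False by (simp add: chi_poly_root_iff)
  qed
  with assms show ?thesis by (meson linorder_neqE)
qed

text \<open>Intermediate value theorem on [1, 2]: the value at 1 is 1 - n < 0, and the value at 2 is
  2^n - (2^n - 1) = 1.\<close>

lemma chi_poly_root_exists:
  assumes "n \<ge> 2"
  shows "\<exists>x > 1. poly (chi_poly n) x = 0"
proof -
  have "(\<Sum>i<n. 2 ^ i) = (2 :: real) ^ n - 1"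
    using power_diff_1_eq[of "2 :: real" n] by simp
  then have "poly (chi_poly n) 2 > 0" by (simp add: poly_chi_poly)
  moreover have "poly (chi_poly n) 1 < 0" using assms by (simp add: poly_chi_poly)
  ultimately obtain x where "1 < x" "poly (chi_poly n) x = 0"
    using poly_IVT_pos[of 1 2 "chi_poly n"] by auto
  then show ?thesis by blast
qed

lemma chi_poly_root_gt_1:
  assumes "n \<ge> 2" "x > 0" "poly (chi_poly n) x = 0"
  shows "x > 1"
proof -
  obtain y where y: "y > 1" "poly (chi_poly n) y = 0"
    using chi_poly_root_exists[OF assms(1)] by blast
  then have "x = y" using assms by (auto intro: chi_poly_root_unique[of n x y])
  with y show ?thesis by simp
qed

text \<open>Multiplication by \<open>x - 1\<close> telescopes the geometric sum: (x - 1) chi(x) =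
  x^(n+1) - 2 x^n + 1.\<close>

lemma chi_poly_root_identity:
  assumes "poly (chi_poly n) x = 0"
  shows "x * x ^ n + 1 = 2 * x ^ n"
proof -
  have "x ^ n - 1 = (x - 1) * x ^ n"
    using power_diff_1_eq[of x n] assms by (simp add: poly_chi_poly)
  then show ?thesis by (simp add: algebra_simps)
qed

text \<open>
  The weighted window sum \<open>\<Sum>l<n. (1 - 1 / r ^ Suc l) * X (j + l)\<close> gets multiplied by \<open>r\<close> in every
  step, hence vanishes for the difference \<open>Z\<close> of \<open>X\<close> and its dominant term. With the recurrence
  this turns \<open>Z (j + n)\<close> into a convex combination of its \<open>n\<close> predecessors.
\<close>

lemma multibonacci_bounded_error:
  fixes X :: "nat \<Rightarrow> real"
  assumes n: "n \<ge> 2" and r: "r > 0" "poly (chi_poly n) r = 0"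
    and rec: "\<And>j. X (j + n) = (\<Sum>l<n. X (j + l))"
    and A: "A * (r ^ n - n / r) = (\<Sum>l<n. (1 - (1 / r) ^ Suc l) * X l)"
  shows "\<exists>M. \<forall>j. \<bar>X j - A * r ^ j\<bar> \<le> M"
proof -
  define \<rho> where "\<rho> = 1 / r"
  define Y where "Y j = (\<Sum>l<n. (1 - \<rho> ^ Suc l) * X (j + l))" for j
  define Z where "Z j = X j - A * r ^ j" for j
  have r\<rho>: "r * \<rho> = 1" using r by (simp add: \<rho>_def)
  have r\<rho>_Suc: "r * \<rho> ^ Suc l = \<rho> ^ l" for l using r\<rho> by (simp flip: mult.assoc)
  have root: "(\<Sum>l<n. r ^ l) = r ^ n" using r(2) by (simp add: poly_chi_poly)
  have "r ^ n * \<rho> ^ n = 1" using r\<rho> by (simp flip: power_mult_distrib)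
  then have "(2 - \<rho> ^ n) * r ^ n = r * r ^ n"
    using chi_poly_root_identity[OF r(2)] by (simp add: algebra_simps)
  \<comment> \<open>The root identity divided by \<open>r ^ n\<close>; it makes the coefficients
    match when the window is shifted.\<close>
  then have key: "2 - \<rho> ^ n = r" using r by simp
  have "Y (Suc j) = r * Y j" for j
  proof -
    \<comment> \<open>The added term is zero. It extends the window to the indices from
      \<open>j\<close> to \<open>j + n\<close>, and the last entry is then expanded by
      \<open>rec\<close>.\<close>
    have "Y (Suc j) + (1 - \<rho> ^ 0) * X j = (\<Sum>l<Suc n. (1 - \<rho> ^ l) * X (j + l))"
      unfolding Y_def sum.lessThan_Suc_shift by simp
    also have "\<dots> = (\<Sum>l<n. (1 - \<rho> ^ l) * X (j + l)) + (1 - \<rho> ^ n) * (\<Sum>l<n. X (j + l))"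
      by (simp add: rec)
    also have "\<dots> = (\<Sum>l<n. (1 - \<rho> ^ l + (1 - \<rho> ^ n)) * X (j + l))"
      unfolding sum_distrib_left sum.distrib[symmetric] distrib_right ..
    also have "\<dots> = (\<Sum>l<n. r * ((1 - \<rho> ^ Suc l) * X (j + l)))"
    proof (intro sum.cong HOL.refl)
      fix l
      have "1 - \<rho> ^ l + (1 - \<rho> ^ n) = r * (1 - \<rho> ^ Suc l)"
        using key r\<rho>_Suc[of l] by (simp add: right_diff_distrib del: power_Suc)
      then show "(1 - \<rho> ^ l + (1 - \<rho> ^ n)) * X (j + l) = r * ((1 - \<rho> ^ Suc l) * X (j + l))"
        by simp
    qed
    finally show ?thesis by (simp add: Y_def sum_distrib_left)
  qed
  then have Y: "Y j = r ^ j * Y 0" for j by (induction j) auto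
  \<comment> \<open>The window sum of the powers of \<open>r\<close> is the factor of
    \<open>A\<close> in the hypothesis, which thus says that \<open>X j\<close> and
    \<open>A * r ^ j\<close> have the same window sum at \<open>j = 0\<close>.\<close>
  have "(\<Sum>l<n. (1 - \<rho> ^ Suc l) * r ^ l) = (\<Sum>l<n. r ^ l - \<rho>)"
  proof (intro sum.cong HOL.refl)
    fix l
    have "\<rho> ^ l * r ^ l = 1" using r\<rho> by (simp add: mult.commute flip: power_mult_distrib)
    then show "(1 - \<rho> ^ Suc l) * r ^ l = r ^ l - \<rho>" by (simp add: algebra_simps)
  qed
  also have "\<dots> = r ^ n - n / r" by (simp add: sum_subtractf root \<rho>_def)
  finally have dominant: "(\<Sum>l<n. (1 - \<rho> ^ Suc l) * r ^ l) = r ^ n - n / r" .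
  have "(\<Sum>l<n. (1 - \<rho> ^ Suc l) * Z (j + l)) = 0" for j
  proof -
    have "(\<Sum>l<n. (1 - \<rho> ^ Suc l) * Z (j + l)) =
        Y j - A * r ^ j * (\<Sum>l<n. (1 - \<rho> ^ Suc l) * r ^ l)"
      unfolding Y_def Z_def sum_distrib_left sum_subtractf[symmetric]
      by (intro sum.cong) (auto simp: power_add algebra_simps)
    also have "\<dots> = 0"
      using A unfolding dominant Y[of j] by (simp add: Y_def \<rho>_def)
    finally show ?thesis .
  qed
  then have null: "(\<Sum>l<n. Z (j + l)) = (\<Sum>l<n. \<rho> ^ Suc l * Z (j + l))" for j
    by (simp add: left_diff_distrib sum_subtractf)
  \<comment> \<open>\<open>Z\<close> inherits the recurrence with unit weights. Subtracting the
    vanishing window sum lowers the weights to \<open>\<rho> ^ Suc l\<close>, which add up to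
    1.\<close>
  have "Z (j + n) = (\<Sum>l<n. \<rho> ^ Suc l * Z (j + l))" for j
    unfolding null[symmetric] unfolding Z_def sum_subtractf rec power_add root[symmetric]
    by (simp add: sum_distrib_left mult.assoc)
  then have "\<bar>Z j\<bar> \<le> (\<Sum>i<n. \<bar>Z i\<bar>)" for j
    using r chi_poly_root_iff[OF r(1), of n]
    by (intro bounded_of_subconvex_recurrence[where w = "\<lambda>l. \<rho> ^ Suc l"]) (auto simp: \<rho>_def)
  then show ?thesis unfolding Z_def by blast
qed


section \<open>Counting compositions with bounded parts\<close>

text \<open>For \<open>n = m - 1\<close> these are the exponent sequences of the normal forms of
  word length at most \<open>k\<close>; the empty list belongs to the identity.\<close>

definition bounded_compositions :: "nat \<Rightarrow> nat \<Rightarrow> nat list set" where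
  "bounded_compositions n k = {is. set is \<subseteq> {1..n} \<and> sum_list is \<le> k}"

text \<open>Split off the first part. The cutoff at \<open>k\<close> keeps the subtraction
  \<open>k - i\<close> exact.\<close>

lemma bounded_compositions_rec:
  "bounded_compositions n k =
     insert [] (\<Union>i\<in>{1..min n k}. (#) i ` bounded_compositions n (k - i))" (is "?L = ?R")
proof
  show "?L \<subseteq> ?R"
  proof
    fix js assume "js \<in> ?L"
    then show "js \<in> ?R"
      by (cases js) (force simp: bounded_compositions_def)+
  qed
qed (auto simp: bounded_compositions_def)

lemma finite_bounded_compositions: "finite (bounded_compositions n k)"
proof (induction k rule: less_induct)
  case (less k)
  show ?case
    unfolding bounded_compositions_rec[of n k] by (auto intro!: less.IH)
qed

lemma card_bounded_compositions_rec:
  "card (bounded_compositions n k) =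
     1 + (\<Sum>i\<in>{1..min n k}. card (bounded_compositions n (k - i)))"
proof -
  have "card (\<Union>i\<in>{1..min n k}. (#) i ` bounded_compositions n (k - i)) =
      (\<Sum>i\<in>{1..min n k}. card ((#) i ` bounded_compositions n (k - i)))"
    by (rule card_UN_disjoint) (auto simp: finite_bounded_compositions)
  moreover have "[] \<notin> (\<Union>i\<in>{1..min n k}. (#) i ` bounded_compositions n (k - i))" by auto
  ultimately show ?thesis
    by (subst bounded_compositions_rec) (simp add: card_image finite_bounded_compositions)
qed

text \<open>Only lists of ones occur, one for each length up to \<open>k\<close>; this is the case m
  = 2.\<close>

lemma card_bounded_compositions_1: "card (bounded_compositions 1 k) = k + 1"
proof (induction k)
  case 0
  then show ?case by (subst card_bounded_compositions_rec) simp
next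
  case (Suc k)
  then show ?case by (subst card_bounded_compositions_rec) simp
qed

text \<open>
  \<open>1 + (n - 1) * card (bounded_compositions n k)\<close>, extended by \<open>n\<close> initial ones, obeys the
  homogeneous recurrence.
\<close>

lemma card_bounded_compositions_asymp:
  assumes n: "n \<ge> 2" and r: "r > 0" "poly (chi_poly n) r = 0"
  defines "D \<equiv> (real n + 1) * r - 2 * real n"
  shows "D > 0" "\<exists>M. \<forall>k. \<bar>real (card (bounded_compositions n k)) - r ^ (k + 1) / D\<bar> \<le> M"
proof -
  define S where "S k = real (card (bounded_compositions n k))" for k
  define X where "X j = (if j < n then 1 else 1 + (real n - 1) * S (j - n))" for j
  have r1: "r > 1" by (rule chi_poly_root_gt_1[OF n r])
  have rec: "X (j + n) = (\<Sum>l<n. X (j + l))" for j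
  proof -
    have "(\<Sum>l<n. X (j + l)) = (\<Sum>i\<in>{1..n}. X (j + n - i))"
      by (rule sum.reindex_bij_witness[where i = "\<lambda>i. n - i" and j = "\<lambda>l. n - l"]) auto
    \<comment> \<open>A window reaching below index \<open>n\<close> meets the initial ones, which
      amounts to \<open>S\<close> being 0 at negative arguments.\<close>
    also have "\<dots> = (\<Sum>i\<in>{1..n}. 1 + (if i \<le> j then (real n - 1) * S (j - i) else 0))"
    proof (intro sum.cong HOL.refl)
      fix i assume "i \<in> {1..n}"
      then have "j + n - i < n \<longleftrightarrow> \<not> i \<le> j" "i \<le> j \<Longrightarrow> j + n - i - n = j - i" by auto
      then show "X (j + n - i) = 1 + (if i \<le> j then (real n - 1) * S (j - i) else 0)"
        by (simp add: X_def)
    qed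
    also have "\<dots> = real n + (\<Sum>i\<in>{1..n}. if i \<le> j then (real n - 1) * S (j - i) else 0)"
      by (simp add: sum.distrib)
    also have "(\<Sum>i\<in>{1..n}. if i \<le> j then (real n - 1) * S (j - i) else 0) =
        (\<Sum>i\<in>{1..min n j}. (real n - 1) * S (j - i))"
      by (rule sum.mono_neutral_cong_right) auto
    also have "real n + \<dots> = X (j + n)"
      by (simp add: X_def S_def card_bounded_compositions_rec[of n j] sum_distrib_left algebra_simps)
    finally show ?thesis by simp
  qed
  \<comment> \<open>The normalising factor of \<open>multibonacci_bounded_error\<close> is a power
    of \<open>r\<close> times the denominator \<open>D\<close>.\<close>
  have D: "r ^ (n - 1) * D = r ^ n - n / r"
  proof -
    have rn: "r ^ n = r ^ (n - 1) * r" using n by (simp flip: power_Suc2)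
    have "r * (r ^ (n - 1) * D) = (real n + 1) * (r * r ^ n) - 2 * n * r ^ n"
      by (simp add: D_def rn algebra_simps)
    also have "\<dots> = r * r ^ n - n"
    proof -
      have *: "r * r ^ n = 2 * r ^ n - 1" using chi_poly_root_identity[OF r(2)] by simp
      show ?thesis unfolding * by (simp add: algebra_simps)
    qed
    also have "\<dots> = r * (r ^ n - n / r)" using r by (simp add: right_diff_distrib)
    finally show ?thesis using r by simp
  qed
  \<comment> \<open>Positivity of \<open>D\<close>: since \<open>r\<close> is a root,
    \<open>r ^ n - n / r\<close> is a sum of \<open>n\<close> positive terms.\<close>
  have "0 < (\<Sum>l<n. r ^ l - 1 / r)"
  proof (intro sum_pos)
    fix l
    have "1 / r < 1" using r1 by simp
    also have "1 \<le> r ^ l" using r1 by simp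
    finally show "0 < r ^ l - 1 / r" by simp
  qed (use n in \<open>auto simp: lessThan_empty_iff\<close>)
  also have "\<dots> = r ^ n - n / r"
    using r(2) by (simp add: poly_chi_poly sum_subtractf)
  finally show D_pos: "D > 0"
    unfolding D[symmetric] using r by (simp add: zero_less_mult_iff)
  \<comment> \<open>On the initial ones the window sum is \<open>n\<close> minus the total weight 1
    of the powers of \<open>1 / r\<close>; this dictates \<open>A\<close>.\<close>
  define A where "A = (real n - 1) / (r ^ (n - 1) * D)"
  have "(\<Sum>l<n. (1 - (1 / r) ^ Suc l) * X l) = real n - 1"
    using chi_poly_root_iff[OF r(1), of n] r(2)
    by (simp add: X_def sum_subtractf del: power_Suc)
  moreover have "A * (r ^ n - n / r) = real n - 1"
    unfolding D[symmetric] A_def using D_pos r by simp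
  ultimately obtain M where M: "\<bar>X j - A * r ^ j\<bar> \<le> M" for j
    using multibonacci_bounded_error[where X = X and A = A and r = r and n = n, OF n r rec] by auto
  \<comment> \<open>Undo the shift by \<open>n\<close> and the affine change; the leftover constant
    1 enters the bound.\<close>
  have "\<bar>S k - r ^ (k + 1) / D\<bar> \<le> (M + 1) / (real n - 1)" for k
  proof -
    have "r ^ (k + n) = r ^ (k + 1) * r ^ (n - 1)"
      using n by (simp flip: power_add power_Suc)
    then have "A * r ^ (k + n) = (real n - 1) * (r ^ (k + 1) / D)"
      using r by (simp add: A_def)
    then have "X (k + n) - A * r ^ (k + n) = 1 + (real n - 1) * (S k - r ^ (k + 1) / D)"
      by (simp add: X_def algebra_simps)
    with M[of "k + n"] have "\<bar>(real n - 1) * (S k - r ^ (k + 1) / D)\<bar> \<le> M + 1" by linarith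
    then show ?thesis
      using n by (simp add: abs_mult pos_le_divide_eq mult.commute)
  qed
  then show "\<exists>M. \<forall>k. \<bar>real (card (bounded_compositions n k)) - r ^ (k + 1) / D\<bar> \<le> M"
    unfolding S_def by blast
qed

section \<open>Normal forms in the free product of two cyclic groups\<close>

text \<open>
  A normal form \<open>x\<^sup>i \<cdot> y\<^sup>j \<cdot> x\<^sup>k \<cdots>\<close> is encoded as the list of its syllables \<open>(x, i), (y, j), (x, k), \<dots>\<close>.
  Following van der Waerden, left multiplication by a
  generator is implemented on syllable lists, so that the effect of a word depends only on the
  group element.
\<close>

primrec alternating :: "gen \<Rightarrow> nat list \<Rightarrow> (gen \<times> nat) list" where
  "alternating x [] = []"
| "alternating x (i # is) = (x, i) # alternating (swap_gen x) is"

definition normal_forms :: "nat \<Rightarrow> (gen \<times> nat) list set" where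
  "normal_forms m = {alternating x is | x is. set is \<subseteq> {1..m - 1}}"

fun gen_act :: "nat \<Rightarrow> gen \<Rightarrow> (gen \<times> nat) list \<Rightarrow> (gen \<times> nat) list" where
  "gen_act m x [] = [(x, 1)]"
| "gen_act m x ((y, i) # w) =
     (if x = y then if Suc i = m then w else (x, Suc i) # w else (x, 1) # (y, i) # w)"

text \<open>An inverse letter acts as the power \<open>m - 1\<close> of its generator, which is an
  inverse wherever the \<open>m\<close>-th power acts trivially.\<close>

definition letter_act :: "nat \<Rightarrow> gen \<times> bool \<Rightarrow> (gen \<times> nat) list \<Rightarrow> (gen \<times> nat) list" where
  "letter_act m l = (if snd l then gen_act m (fst l) else gen_act m (fst l) ^^ (m - 1))"

abbreviation word_act :: "nat \<Rightarrow> (gen \<times> bool) list \<Rightarrow> (gen \<times> nat) list \<Rightarrow> (gen \<times> nat) list" where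
  "word_act m \<equiv> foldr (letter_act m)"

definition spell :: "(gen \<times> nat) list \<Rightarrow> (gen \<times> bool) list" where
  "spell w = concat (map (\<lambda>(x, i). replicate i (x, True)) w)"

abbreviation swap_word :: "(gen \<times> bool) list \<Rightarrow> (gen \<times> bool) list" where
  "swap_word \<equiv> map (\<lambda>(x, s). (swap_gen x, s))"

lemma swap_gen_swap_gen [simp]: "swap_gen (swap_gen x) = x"
  by (cases x) auto

lemma swap_gen_neq [simp]: "swap_gen x \<noteq> x" "x \<noteq> swap_gen x"
  by (cases x; simp)+

lemma neq_iff_eq_swap_gen: "x \<noteq> y \<longleftrightarrow> y = swap_gen x"
  by (cases x; cases y) auto

lemma map_snd_alternating [simp]: "map snd (alternating x is) = is"
  by (induction "is" arbitrary: x) auto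

lemma alternating_in_normal_forms:
  "set is \<subseteq> {1..m - 1} \<Longrightarrow> alternating x is \<in> normal_forms m"
  by (auto simp: normal_forms_def)

section \<open>Powers of a generator acting on normal forms\<close>

lemma gen_act_alternating_swap:
  "gen_act m x (alternating (swap_gen x) is) = alternating x (1 # is)"
  by (cases "is") auto

lemma gen_act_pow:
  assumes "i < m"
  shows "(gen_act m x ^^ i) (alternating (swap_gen x) is) =
    (if i = 0 then alternating (swap_gen x) is else alternating x (i # is))"
  using assms
proof (induction i)
  case (Suc i)
  then show ?case using gen_act_alternating_swap[of m x "is"] by (cases i) auto
qed simp

text \<open>Every normal form arises by powers of \<open>x\<close> from one that does not start with
  \<open>x\<close>, so the action of \<open>x\<close> need only be followed from such lists.\<close>

lemma normal_form_cases:
  assumes "m \<ge> 2" "w \<in> normal_forms m"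
  obtains i "is" where "i < m" "set is \<subseteq> {1..m - 1}"
    "w = (gen_act m x ^^ i) (alternating (swap_gen x) is)"
proof -
  obtain y js where w: "w = alternating y js" "set js \<subseteq> {1..m - 1}"
    using assms(2) by (auto simp: normal_forms_def)
  show ?thesis
  proof (cases "x = y \<and> js \<noteq> []")
    case True
    then obtain i "is" where js: "js = i # is" by (cases js) auto
    with w assms(1) have "i < m" "i \<noteq> 0" "set is \<subseteq> {1..m - 1}" by auto
    with True w js show ?thesis by (intro that[of i "is"]) (simp_all add: gen_act_pow)
  next
    case False
    then have "w = alternating (swap_gen x) js"
      using w(1) neq_iff_eq_swap_gen[of x y] by (cases js) auto
    with w assms(1) show ?thesis by (intro that[of 0 js]) auto
  qed
qed

text \<open>Starting from a list without leading \<open>x\<close>, \<open>m - 1\<close> steps build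
  a syllable and one more deletes it. The other normal forms follow because powers of
  \<open>gen_act m x\<close> commute.\<close>

lemma gen_act_pow_order:
  assumes m: "m \<ge> 2" and w: "w \<in> normal_forms m"
  shows "(gen_act m x ^^ m) w = w"
proof -
  obtain i "is" where i: "i < m" "w = (gen_act m x ^^ i) (alternating (swap_gen x) is)"
    by (rule normal_form_cases[OF assms])
  have "(gen_act m x ^^ m) (alternating (swap_gen x) is) =
      gen_act m x ((gen_act m x ^^ (m - 1)) (alternating (swap_gen x) is))"
    using m by (cases m) auto
  also have "\<dots> = alternating (swap_gen x) is"
    using m by (subst gen_act_pow) auto
  finally have "(gen_act m x ^^ i) ((gen_act m x ^^ m) (alternating (swap_gen x) is)) = w"
    using i by simp
  then show ?thesis
    unfolding i(2) by (metis add.commute comp_apply funpow_add)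
qed

lemma gen_act_closed:
  assumes m: "m \<ge> 2" and w: "w \<in> normal_forms m"
  shows "gen_act m x w \<in> normal_forms m"
proof -
  obtain i "is" where i: "i < m" "set is \<subseteq> {1..m - 1}"
      "w = (gen_act m x ^^ i) (alternating (swap_gen x) is)"
    by (rule normal_form_cases[OF assms])
  then have w: "gen_act m x w = (gen_act m x ^^ Suc i) (alternating (swap_gen x) is)" by simp
  show ?thesis
  proof (cases "Suc i = m")
    \<comment> \<open>The leading syllable reaches exponent \<open>m\<close> and disappears.\<close>
    case True
    then show ?thesis
      using i(2) m unfolding w by (simp only: gen_act_pow_order alternating_in_normal_forms)
  next
    case False
    then have "gen_act m x w = alternating x (Suc i # is)"
      using i(1) unfolding w by (subst gen_act_pow) auto
    moreover have "set (Suc i # is) \<subseteq> {1..m - 1}" using i False by auto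
    ultimately show ?thesis by (simp only: alternating_in_normal_forms)
  qed
qed

lemma letter_act_True [simp]: "letter_act m (x, True) = gen_act m x"
  by (simp add: letter_act_def)

lemma letter_act_closed:
  assumes "m \<ge> 2" "w \<in> normal_forms m"
  shows "letter_act m l w \<in> normal_forms m"
proof -
  have "(gen_act m x ^^ i) w \<in> normal_forms m" for x i
    by (induction i) (auto simp: assms gen_act_closed)
  then show ?thesis using assms by (simp add: letter_act_def gen_act_closed)
qed

lemma word_act_closed:
  "m \<ge> 2 \<Longrightarrow> w \<in> normal_forms m \<Longrightarrow> word_act m u w \<in> normal_forms m"
  by (induction u) (auto simp: letter_act_closed)

text \<open>A letter next to its inverse, and likewise each relator, acts as an \<open>m\<close>-th
  power of a generator, hence trivially on normal forms.\<close>

lemma word_act_cong: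
  assumes m: "m \<ge> 2" and "(u, v) \<in> word_eq (cyclic_relators m)" "w \<in> normal_forms m"
  shows "word_act m u w = word_act m v w"
  using assms(2,3)
proof (induction arbitrary: w rule: word_eq.induct)
  case (cancel u x s v)
  define z where "z = word_act m v w"
  have z: "(gen_act m x ^^ m) z = z"
    using m cancel by (simp add: z_def word_act_closed gen_act_pow_order)
  obtain k where k: "m = Suc k" using m by (cases m) auto
  have "letter_act m (x, s) (letter_act m (x, \<not> s) z) = z"
    using z by (cases s) (simp_all add: letter_act_def k flip: funpow_swap1)
  then show ?case by (simp add: z_def)
next
  case (relator r u v)
  then obtain x where "r = replicate m (x, True)" by (auto simp: cyclic_relators_def)
  then show ?case
    using relator m by (simp add: word_act_closed gen_act_pow_order)
qed auto

section \<open>Uniqueness and existence of normal forms\<close>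

lemma word_act_spell:
  assumes "m \<ge> 2" "set is \<subseteq> {1..m - 1}"
  shows "word_act m (spell (alternating x is)) [] = alternating x is"
  using assms(2)
proof (induction "is" arbitrary: x)
  case (Cons i "is")
  then have "word_act m (spell (alternating x (i # is))) [] =
      (gen_act m x ^^ i) (alternating (swap_gen x) is)"
    by (simp add: spell_def)
  moreover have "i < m" "i \<noteq> 0" using Cons.prems assms(1) by auto
  ultimately show ?case by (simp add: gen_act_pow)
qed (simp add: spell_def)

text \<open>Acting on the empty list recovers both syllable lists. Starting generators are left out
  of the conclusion: an empty list has none, and \<phi> exchanges them anyway.\<close>

lemma word_eq_spell_imp_eq:
  assumes "m \<ge> 2" "set is \<subseteq> {1..m - 1}" "set js \<subseteq> {1..m - 1}"
    and "(spell (alternating x is), spell (alternating y js)) \<in> word_eq (cyclic_relators m)"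
  shows "is = js"
proof -
  have "[] \<in> normal_forms m" using alternating_in_normal_forms[of "[]" m] by simp
  from word_act_cong[OF assms(1,4) this] have "alternating x is = alternating y js"
    by (simp only: word_act_spell assms)
  then show ?thesis by (metis map_snd_alternating)
qed

lemma length_spell_alternating: "length (spell (alternating x is)) = sum_list is"
  by (induction "is" arbitrary: x) (auto simp: spell_def)

lemma spell_alternating_positive: "\<exists>v. spell (alternating x is) = map (\<lambda>x. (x, True)) v"
proof -
  have "map (\<lambda>x. (x, True)) (map fst w) = w" if "\<forall>l\<in>set w. snd l" for w :: "(gen \<times> bool) list"
    using that by (induction w) auto
  moreover have "\<forall>l\<in>set (spell (alternating x is)). snd l"
    by (auto simp: spell_def)
  ultimately show ?thesis by metis
qed

lemma swap_word_spell: "swap_word (spell (alternating x is)) = spell (alternating (swap_gen x) is)"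
  by (induction "is" arbitrary: x) (auto simp: spell_def)

text \<open>\<open>gen_act\<close> realises left multiplication in the group: the two words differ
  only when a full syllable is deleted, and this is an application of a relator.\<close>

lemma word_eq_spell_gen_act:
  "((x, True) # spell w, spell (gen_act m x w)) \<in> word_eq (cyclic_relators m)"
proof (cases "\<exists>w'. w = (x, m - 1) # w' \<and> m \<ge> 1")
  case True
  then obtain w' k where w': "w = (x, k) # w'" "m = Suc k" by (cases m) auto
  have "replicate m (x, True) \<in> cyclic_relators m"
    by (cases x) (auto simp: cyclic_relators_def)
  from word_eq.relator[OF this, of "[]" "spell w'"] show ?thesis
    by (simp add: w' spell_def)
next
  case False
  then have "spell (gen_act m x w) = (x, True) # spell w"
    by (cases "(m, x, w)" rule: gen_act.cases) (auto simp: spell_def)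
  then show ?thesis by (simp add: word_eq.refl)
qed

lemma length_spell_gen_act: "length (spell (gen_act m x w)) \<le> Suc (length (spell w))"
  by (cases "(m, x, w)" rule: gen_act.cases) (auto simp: spell_def)

text \<open>Let the word act on the empty list. Each letter lengthens the spelled form by at most
  one, hence the bound on the exponent sum.\<close>

lemma positive_word_normal_form:
  assumes m: "m \<ge> 2"
  obtains x "is" where "set is \<subseteq> {1..m - 1}" "sum_list is \<le> length v"
    "(map (\<lambda>x. (x, True)) v, spell (alternating x is)) \<in> word_eq (cyclic_relators m)"
proof -
  define w where "w = word_act m (map (\<lambda>x. (x, True)) v) []"
  have "[] \<in> normal_forms m" using alternating_in_normal_forms[of "[]" m] by simp
  then have "w \<in> normal_forms m" unfolding w_def by (rule word_act_closed[OF m])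
  then obtain x "is" where w: "w = alternating x is" and "is": "set is \<subseteq> {1..m - 1}"
    by (auto simp: normal_forms_def)
  have "length (spell w) \<le> length v"
    unfolding w_def
  proof (induction v)
    case (Cons x v)
    then show ?case
      using length_spell_gen_act[of m x "word_act m (map (\<lambda>x. (x, True)) v) []"]
      by simp
  qed (simp add: spell_def)
  moreover have "(map (\<lambda>x. (x, True)) v, spell w) \<in> word_eq (cyclic_relators m)"
    unfolding w_def
  proof (induction v)
    case (Cons x v)
    then have "((x, True) # map (\<lambda>x. (x, True)) v,
        (x, True) # spell (word_act m (map (\<lambda>x. (x, True)) v) [])) \<in> word_eq (cyclic_relators m)"
      using word_eq_context[of _ _ _ "[(x, True)]" "[]"] by simp
    then show ?case
      using word_eq.trans[OF _ word_eq_spell_gen_act] by simp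
  qed (simp add: spell_def word_eq.refl)
  ultimately show ?thesis
    using "is" by (intro that[of "is" x]) (simp_all add: w length_spell_alternating)
qed


section \<open>The growth function\<close>

lemma coset_proj_swap:
  assumes m: "m \<ge> 2" and \<phi>: "\<phi> \<in> auto (cyclic_free_product m)"
    and ab: "\<phi> (elem_a m) = elem_b m" "\<phi> (elem_b m) = elem_a m"
    and x: "x \<in> carrier (cyclic_free_product m)"
  shows "coset_proj (cyclic_free_product m) \<phi> x = {x, \<phi> x}"
proof -
  interpret G: group "cyclic_free_product m" by (rule group_presented_group)
  have hom: "\<phi> \<in> hom (cyclic_free_product m) (cyclic_free_product m)"
    using \<phi> by (simp add: auto_def)
  have pow: "(\<phi> ^^ i) x = (if even i then x else \<phi> x)" for i
    by (induction i) (auto simp: swap_hom_involution[OF hom ab x])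
  have "range (\<lambda>i. (\<phi> ^^ i) x) = {x, \<phi> x}"
    unfolding pow by (auto intro: rev_image_eqI[of 0] rev_image_eqI[of 1])
  then show ?thesis
    using G.coset_proj_eq[OF \<phi> _ x] swap_automorphism_order[OF m \<phi> ab] by simp
qed

text \<open>With \<open>a\<close> representing g, the values of g * \<pi>(v) are \<pi>(a v) and
  \<pi>(a \<phi>(v)) = \<pi>(b v), as \<phi> is an involution. Multiplication by g thus prepends
  either letter.\<close>

lemma set_mset_coset_pow:
  assumes m: "m \<ge> 2" and \<phi>: "\<phi> \<in> auto (cyclic_free_product m)"
    and ab: "\<phi> (elem_a m) = elem_b m" "\<phi> (elem_b m) = elem_a m"
  shows "set_mset (coset_pow (cyclic_free_product m) \<phi> {elem_a m, elem_b m} k) =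
    (\<lambda>v. coset_proj (cyclic_free_product m) \<phi>
      (word_eq (cyclic_relators m) `` {map (\<lambda>x. (x, True)) v})) ` {v. length v = k}"
    (is "set_mset (coset_pow ?G \<phi> ?g k) = ?\<pi> ` _")
proof -
  interpret G: group ?G by (rule group_presented_group)
  define cls where "cls u = word_eq (cyclic_relators m) `` {u}" for u
  have hom: "\<phi> \<in> hom ?G ?G" using \<phi> by (simp add: auto_def)
  have ord: "group.ord (AutoGroup ?G) \<phi> = 2" by (rule swap_automorphism_order[OF m \<phi> ab])
  then have ord_pos: "group.ord (AutoGroup ?G) \<phi> > 0" by simp
  have cls: "cls u \<in> carrier ?G" for u by (auto simp: cls_def presented_carrier_iff)
  have \<phi>_cls: "\<phi> (cls u) = cls (swap_word u)" for u
    unfolding cls_def by (rule swap_hom_apply[OF hom ab])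
  have \<pi>_cls: "coset_proj ?G \<phi> (cls (swap_word u)) = coset_proj ?G \<phi> (cls u)" for u
    using G.coset_proj_funpow[OF \<phi> _ cls, of 1 u] by (simp add: ord \<phi>_cls)
  have gen: "presented_gen (cyclic_relators m) x = cls [(x, True)]" for x
    by (simp add: cls_def presented_gen_def)
  have g: "?g = coset_proj ?G \<phi> (cls [(Gen_a, True)])"
    using coset_proj_elem_a[OF m \<phi> ab] by (simp add: gen)
  have mult: "cls u \<otimes>\<^bsub>?G\<^esub> cls v = cls (u @ v)" for u v
    unfolding cls_def by (rule presented_mult)
  have \<pi>: "?\<pi> v = coset_proj ?G \<phi> (cls (map (\<lambda>x. (x, True)) v))" for v by (simp add: cls_def)
  have step: "set_mset (coset_mult ?G \<phi> ?g (?\<pi> v)) = {?\<pi> (Gen_a # v), ?\<pi> (Gen_b # v)}" for v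
  proof -
    have "{..<2 :: nat} = {0, 1}" by auto
    moreover have "coset_proj ?G \<phi> (cls ((Gen_a, True) # swap_word (map (\<lambda>x. (x, True)) v))) =
        ?\<pi> (Gen_b # v)"
      using \<pi>_cls[of "map (\<lambda>x. (x, True)) (Gen_b # v)"] by (simp add: cls_def comp_def)
    ultimately show ?thesis
      unfolding g \<pi> unfolding G.coset_mult_proj[OF \<phi> ord_pos cls cls] ord
      by (simp add: \<phi>_cls mult)
  qed
  show ?thesis
  proof (induction k)
    case 0
    show ?case by (simp add: coset_one_def presented_one)
  next
    case (Suc j)
    note IH = Suc.IH
    show ?case
    proof (cases j)
      case 0
      \<comment> \<open>The recursion of \<open>coset_pow\<close> starts afresh at exponent 1, where
        both one-letter words represent g.\<close>
      have "?\<pi> [Gen_a] = ?g" "?\<pi> [Gen_b] = ?g"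
        using \<pi>_cls[of "[(Gen_a, True)]"] unfolding \<pi> g by simp_all
      moreover have "{v. length v = Suc 0} = {[Gen_a], [Gen_b]}"
      proof -
        have "x = Gen_a \<or> x = Gen_b" for x by (cases x) auto
        then show ?thesis by (auto simp: length_Suc_conv)
      qed
      ultimately show ?thesis by (simp add: 0)
    next
      case (Suc k)
      have "set_mset (coset_pow ?G \<phi> ?g (Suc (Suc k))) =
          (\<Union>v\<in>{v. length v = Suc k}. {?\<pi> (Gen_a # v), ?\<pi> (Gen_b # v)})"
        using IH step by (simp add: Suc)
      also have "\<dots> = ?\<pi> ` (\<Union>v\<in>{v. length v = Suc k}. {Gen_a # v, Gen_b # v})" by blast
      also have "(\<Union>v\<in>{v. length v = Suc k}. {Gen_a # v, Gen_b # v}) = {v. length v = Suc (Suc k)}"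
        using gen.exhaust by (auto simp: length_Suc_conv)
      finally show ?thesis by (simp only: Suc)
    qed
  qed
qed

text \<open>An orbit consists of the normal forms with a common exponent list, one for each starting
  generator, so exponent lists classify orbits. Word length at most \<open>k\<close> becomes
  exponent sum at most \<open>k\<close>.\<close>

lemma coset_growth_cyclic_free_product:
  assumes m: "m \<ge> 2" and \<phi>: "\<phi> \<in> auto (cyclic_free_product m)"
    and ab: "\<phi> (elem_a m) = elem_b m" "\<phi> (elem_b m) = elem_a m"
  shows "coset_growth (cyclic_free_product m) \<phi> {elem_a m, elem_b m} k =
    card (bounded_compositions (m - 1) k)"
proof -
  let ?G = "cyclic_free_product m"
  define cls where "cls u = word_eq (cyclic_relators m) `` {u}" for u
  define nf where "nf x is = cls (spell (alternating x is))" for x "is"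
  have hom: "\<phi> \<in> hom ?G ?G" using \<phi> by (simp add: auto_def)
  have cls: "cls u \<in> carrier ?G" for u by (auto simp: cls_def presented_carrier_iff)
  have "coset_proj ?G \<phi> (nf x is) = {nf x is, nf (swap_gen x) is}" for x "is"
    unfolding nf_def coset_proj_swap[OF m \<phi> ab cls]
    by (simp add: cls_def swap_hom_apply[OF hom ab] swap_word_spell)
  then have \<pi>: "coset_proj ?G \<phi> (nf x is) = {nf Gen_a is, nf Gen_b is}" for x "is"
    by (cases x) auto
  let ?P = "\<lambda>v. coset_proj ?G \<phi> (cls (map (\<lambda>x. (x, True)) v))"
  have "{coset_one ?G \<phi>} \<union> (\<Union>j\<in>{1..k}. set_mset (coset_pow ?G \<phi> {elem_a m, elem_b m} j)) =
      ?P ` {v. length v \<le> k}"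
  proof -
    have "{coset_one ?G \<phi>} = ?P ` {v. length v = 0}"
      by (simp add: coset_one_def presented_one cls_def)
    then have "{coset_one ?G \<phi>} \<union> (\<Union>j\<in>{1..k}. set_mset (coset_pow ?G \<phi> {elem_a m, elem_b m} j)) =
        (\<Union>j\<in>{0} \<union> {1..k}. ?P ` {v. length v = j})"
      by (simp add: set_mset_coset_pow[OF assms] cls_def)
    also have "{0} \<union> {1..k} = {..k}" by auto
    also have "(\<Union>j\<in>{..k}. ?P ` {v. length v = j}) = ?P ` {v. length v \<le> k}" by auto
    finally show ?thesis .
  qed
  also have "\<dots> = (\<lambda>is. {nf Gen_a is, nf Gen_b is}) ` bounded_compositions (m - 1) k"
  proof (intro equalityI subsetI)
    fix A assume "A \<in> ?P ` {v. length v \<le> k}"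
    then obtain v where v: "length v \<le> k" "A = ?P v" by blast
    obtain x "is" where "is": "set is \<subseteq> {1..m - 1}" "sum_list is \<le> length v"
      "(map (\<lambda>x. (x, True)) v, spell (alternating x is)) \<in> word_eq (cyclic_relators m)"
      by (rule positive_word_normal_form[OF m])
    then have "cls (map (\<lambda>x. (x, True)) v) = nf x is"
      by (simp add: cls_def nf_def word_class_eq_iff)
    with v "is" show "A \<in> (\<lambda>is. {nf Gen_a is, nf Gen_b is}) ` bounded_compositions (m - 1) k"
      by (auto simp: \<pi> bounded_compositions_def)
  next
    fix A assume "A \<in> (\<lambda>is. {nf Gen_a is, nf Gen_b is}) ` bounded_compositions (m - 1) k"
    then obtain "is" where "is": "is \<in> bounded_compositions (m - 1) k"
      "A = coset_proj ?G \<phi> (nf Gen_a is)"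
      by (auto simp: \<pi>)
    obtain v where v: "spell (alternating Gen_a is) = map (\<lambda>x. (x, True)) v"
      using spell_alternating_positive by blast
    have "length v = sum_list is"
      using length_spell_alternating[of Gen_a "is"] unfolding v by simp
    with "is" v show "A \<in> ?P ` {v. length v \<le> k}"
      by (auto simp: nf_def bounded_compositions_def)
  qed
  finally have "coset_growth ?G \<phi> {elem_a m, elem_b m} k =
      card ((\<lambda>is. {nf Gen_a is, nf Gen_b is}) ` bounded_compositions (m - 1) k)"
    by (simp add: coset_growth_def)
  also have "\<dots> = card (bounded_compositions (m - 1) k)"
  proof (rule card_image, rule inj_onI)
    fix "is" js
    assume *: "is \<in> bounded_compositions (m - 1) k" "js \<in> bounded_compositions (m - 1) k"
      and "{nf Gen_a is, nf Gen_b is} = {nf Gen_a js, nf Gen_b js}"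
    \<comment> \<open>Equal orbits both contain \<open>nf Gen_a is\<close>, whichever generator the
      other normal form starts with.\<close>
    then have "nf Gen_a is = nf Gen_a js \<or> nf Gen_a is = nf Gen_b js"
      by (simp add: doubleton_eq_iff) blast
    then obtain y where "nf Gen_a is = nf y js" by blast
    with * show "is = js"
      using word_eq_spell_imp_eq[OF m, of "is" js Gen_a y]
      by (auto simp: bounded_compositions_def nf_def cls_def word_class_eq_iff)
  qed
  finally show ?thesis .
qed

section \<open>Consequences of a bounded error\<close>

lemma asymp_equiv_of_bounded_diff:
  fixes f :: "nat \<Rightarrow> real"
  assumes r: "r > 1" and c: "c > 0" and M: "\<And>k. \<bar>f k - r ^ (k + 1) / c\<bar> \<le> M"
  shows "f \<sim>[at_top] (\<lambda>k. r ^ (k + 1) / c)"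
proof (rule asymp_equivI')
  \<comment> \<open>The relative error is at most \<open>M * c / r ^ (k + 1)\<close>.\<close>
  have "((\<lambda>k. f k / (r ^ (k + 1) / c) - 1) \<longlongrightarrow> 0) at_top"
  proof (rule tendsto_0_le)
    show "\<forall>\<^sub>F k in at_top.
        norm (f k / (r ^ (k + 1) / c) - 1) \<le> norm (1 / r ^ (k + 1)) * (M * c)"
    proof (intro always_eventually allI)
      fix k
      have "f k / (r ^ (k + 1) / c) - 1 = (f k - r ^ (k + 1) / c) * (c / r ^ (k + 1))"
        using r c by (simp add: field_simps)
      then show "norm (f k / (r ^ (k + 1) / c) - 1) \<le> norm (1 / r ^ (k + 1)) * (M * c)"
        using mult_right_mono[OF M[of k], of "c / r ^ (k + 1)"] r c by (simp add: abs_mult)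
    qed
    show "((\<lambda>k :: nat. 1 / r ^ (k + 1)) \<longlongrightarrow> 0) at_top"
      using r by real_asymp
  qed
  from tendsto_add[OF this tendsto_const[of 1]] show "((\<lambda>k. f k / (r ^ (k + 1) / c)) \<longlongrightarrow> 1) at_top"
    by simp
qed

text \<open>Under polynomial growth, division by \<open>r ^ (k + 1)\<close> would bound the positive
  constant \<open>1 / c\<close> by a null sequence.\<close>

lemma not_polynomial_growth_of_bounded_diff:
  assumes r: "r > 1" and c: "c > 0" and M: "\<And>k. \<bar>real (\<xi> k) - r ^ (k + 1) / c\<bar> \<le> M"
  shows "\<not> polynomial_growth \<xi>"
proof
  assume "polynomial_growth \<xi>"
  then obtain C d :: real where C: "C > 0" "d > 0" "\<And>k. real (\<xi> k) \<le> C * (real k + 1) powr d"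
    by (auto simp: polynomial_growth_def)
  have "r ^ (k + 1) / c \<le> M + C * (real k + 1) powr d" for k
    using M[of k] C(3)[of k] by linarith
  then have "1 / c \<le> (M + C * (real k + 1) powr d) / r ^ (k + 1)" for k
    using r by (simp add: pos_le_divide_eq)
  moreover have "(\<lambda>k :: nat. (M + C * (real k + 1) powr d) / r ^ (k + 1)) \<longlonglongrightarrow> 0"
    using r C by real_asymp
  ultimately have "1 / c \<le> 0" by (intro LIMSEQ_le_const) auto
  with c show False by simp
qed

theorem proposition5:
  fixes m :: nat and \<phi> :: "(gen \<times> bool) list set \<Rightarrow> (gen \<times> bool) list set"
  assumes "m \<ge> 2"
    and "\<phi> \<in> auto (cyclic_free_product m)"
    and "group.ord (AutoGroup (cyclic_free_product m)) \<phi> = 2"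
    and "\<phi> (elem_a m) = elem_b m"
    and "\<phi> (elem_b m) = elem_a m"
  shows
    "(m \<ge> 3 \<longrightarrow>
       (\<exists>!r :: real. r > 0 \<and> poly (chi_poly (m - 1)) r = 0) \<and>
       (\<forall>r :: real. r > 0 \<and> poly (chi_poly (m - 1)) r = 0 \<longrightarrow>
         (\<lambda>k. real (coset_growth (cyclic_free_product m) \<phi> {elem_a m, elem_b m} k))
           \<sim>[at_top] (\<lambda>k. r ^ (k + 1) / (real m * r - 2 * (real m - 1))))) \<and>
     (polynomial_growth (coset_growth (cyclic_free_product m) \<phi> {elem_a m, elem_b m}) \<longleftrightarrow> m = 2)"
proof -
  let ?\<xi> = "coset_growth (cyclic_free_product m) \<phi> {elem_a m, elem_b m}"
  have \<xi>: "?\<xi> k = card (bounded_compositions (m - 1) k)" for k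
    using assms by (intro coset_growth_cyclic_free_product)
  \<comment> \<open>With \<open>n = m - 1\<close> the denominator \<open>(n + 1) * r - 2 * n\<close>
    becomes the one claimed.\<close>
  have asymp: "r > 1" "real m * r - 2 * (real m - 1) > 0"
      "\<exists>M. \<forall>k. \<bar>real (?\<xi> k) - r ^ (k + 1) / (real m * r - 2 * (real m - 1))\<bar> \<le> M"
    if "m \<ge> 3" "r > 0" "poly (chi_poly (m - 1)) r = 0" for r
    using card_bounded_compositions_asymp[of "m - 1" r] chi_poly_root_gt_1[of "m - 1" r] that
    by (simp_all add: \<xi> of_nat_diff)
  have root: "\<exists>!r :: real. r > 0 \<and> poly (chi_poly (m - 1)) r = 0" if m3: "m \<ge> 3"
  proof -
    from m3 have n: "m - 1 \<ge> 2" by simp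
    then obtain r where "r > 1" "poly (chi_poly (m - 1)) r = 0"
      using chi_poly_root_exists by blast
    then show ?thesis
      using chi_poly_root_unique[of "m - 1" _ r] n by (intro ex1I[of _ r]) auto
  qed
  have "(\<lambda>k. real (?\<xi> k)) \<sim>[at_top] (\<lambda>k. r ^ (k + 1) / (real m * r - 2 * (real m - 1)))"
    if "m \<ge> 3" "r > 0" "poly (chi_poly (m - 1)) r = 0" for r
    using asymp[OF that] by (blast intro: asymp_equiv_of_bounded_diff)
  moreover have "polynomial_growth ?\<xi> \<longleftrightarrow> m = 2"
  proof
    assume poly: "polynomial_growth ?\<xi>"
    show "m = 2"
    proof (rule ccontr)
      assume "m \<noteq> 2"
      with assms(1) have "m \<ge> 3" by simp
      moreover from root[OF this] obtain r where "r > 0" "poly (chi_poly (m - 1)) r = 0" by blast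
      ultimately show False
        using asymp[of r] not_polynomial_growth_of_bounded_diff[of r] poly by blast
    qed
  next
    assume "m = 2"
    \<comment> \<open>Here the growth function is exactly \<open>k + 1\<close>, so C = d = 1 will
      do.\<close>
    then have "real (?\<xi> k) \<le> 1 * (real k + 1) powr 1" for k
      using \<xi>[of k] card_bounded_compositions_1[of k] by simp
    then show "polynomial_growth ?\<xi>"
      unfolding polynomial_growth_def by (intro exI[of _ 1]) auto
  qed
  ultimately show ?thesis using root by blast
qed

end
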